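(* Let $A$ be a finite alphabet with at least two letters and let $\sigma:A\to A^+$ be an aperiodic, primitive substitution with fixed point $u\in A^{\mathbb{Z}_+}$. Then $\sigma$ has the local unique composition property under the index $$L_0=\{C^4(K+1)+2C^2+1\}\,S_{p_0},$$ where $$p_0=K^2\left\{C^4(K+1)+2C^2+1\right\}\times\left(\sum_{n=C^2(K+1)+2}^{(K+1)C^6+2C^4+C^2+2}n\right)+1.$$
   Context: $\mathbb{N}=\{1,2,\dots\}$, $\mathbb{Z}_+=\{0\}\cup\mathbb{N}$. $A^+$ is the set of nonempty finite words over $A$; $|w|$ is the length of $w$. A substitution $\sigma:A\to A^+$ is extended to words and sequences by concatenation. It is primitive if there is $k\in\mathbb{N}$ such that every letter $a$ occurs in $\sigma^k(b)$ for all $a,b\in A$. It is assumed that $\sigma$ has a fixed point $u=\sigma(u)\in A^{\mathbb{Z}_+}$. $\sigma$ is aperiodic if $T^iu\neq u$ for all $i\in\mathbb{N}$, $T$ being the left shift. $u_{[i,j)}=u_i\cdots u_{j-1}$. $\mathcal{L}_2(u)$ is the set of words of length $2$ occurring in $u$. Constants. $S_p=\max_{a\in A}|\sigma^p(a)|$. $M_\sigma$ is the $A\times A$ matrix whose $(a,b)$-entry is the number of occurrences of $b$ in $\sigma(a)$; $\lambda$ is its Perron eigenvalue and $\beta=(\beta_a)_{a\in A}$ a positive right eigenvector for $\lambda$; $C=\lceil\max_b\beta_b/\min_b\beta_b\rceil$. For $w\in\mathcal{L}_2(u)$, the gap of $w$ is the least $g_w\in\mathbb{N}$ such that every interval of $g_w$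 consecutive integers in $\mathbb{Z}_+$ contains an $i$ with $u_{[i,i+2)}=w$; $g=\max_{w\in\mathcal{L}_2(u)}g_w$. $K=\lceil\lambda C^2\max\{2(g+1),(\#A)^2\}\rceil$. Let $E_1=\{0\}\cup\{|\sigma(u_{[0,n)})|:n\in\mathbb{N}\}$. $\sigma$ is bilaterally recognizable under the index $L\in\mathbb{N}$ if, whenever $i,j\ge L$, $u_{[i-L,i+L)}=u_{[j-L,j+L)}$ and $i\in E_1$, then $j\in E_1$. $\sigma$ has the local unique composition property under the index $L\in\mathbb{N}$ if $\sigma$ is bilaterally recognizable under the index $L$ and, moreover, whenever $i,j\ge L$, $m,n\in\mathbb{Z}_+$, $u_{[i-L,i+L)}=u_{[j-L,j+L)}$, $|\sigma(u_{[0,m)})|\le i<|\sigma(u_{[0,m+1)})|$ and $|\sigma(u_{[0,n)})|\le j<|\sigma(u_{[0,n+1)})|$, then $u_m=u_n$. *)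

theory Defs
  imports "HOL-Analysis.Analysis"
begin

text \<open>The alphabet is a type of class finite; words are lists and one-sided sequences are
  functions on the natural numbers.\<close>

definition factor :: "(nat \<Rightarrow> 'a) \<Rightarrow> nat \<Rightarrow> nat \<Rightarrow> 'a list" where
  "factor u i j = map u [i..<j]"

definition shift_seq :: "(nat \<Rightarrow> 'a) \<Rightarrow> nat \<Rightarrow> 'a" where
  "shift_seq u = (\<lambda>i. u (Suc i))"

definition substitution :: "('a \<Rightarrow> 'a list) \<Rightarrow> bool" where
  "substitution \<sigma> \<longleftrightarrow> (\<forall>a. \<sigma> a \<noteq> [])"

definition subst_word :: "('a \<Rightarrow> 'a list) \<Rightarrow> 'a list \<Rightarrow> 'a list" where
  "subst_word \<sigma> w = concat (map \<sigma> w)"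

text \<open>The \<open>i\<close>-th letter of the infinite concatenation of \<open>\<sigma> (u 0)\<close>, \<open>\<sigma> (u 1)\<close>, and so on. As images
  of letters are nonempty, the image of the prefix of length \<open>i + 1\<close> is long enough to contain it.\<close>

definition subst_seq :: "('a \<Rightarrow> 'a list) \<Rightarrow> (nat \<Rightarrow> 'a) \<Rightarrow> nat \<Rightarrow> 'a" where
  "subst_seq \<sigma> u = (\<lambda>i. subst_word \<sigma> (factor u 0 (Suc i)) ! i)"

definition primitive_subst :: "('a \<Rightarrow> 'a list) \<Rightarrow> bool" where
  "primitive_subst \<sigma> \<longleftrightarrow> (\<exists>k\<ge>1. \<forall>a b. a \<in> set ((subst_word \<sigma> ^^ k) [b]))"

definition aperiodic_seq :: "(nat \<Rightarrow> 'a) \<Rightarrow> bool" where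
  "aperiodic_seq u \<longleftrightarrow> (\<forall>i\<ge>1. (shift_seq ^^ i) u \<noteq> u)"

definition max_image_length :: "('a::finite \<Rightarrow> 'a list) \<Rightarrow> nat \<Rightarrow> nat" where
  "max_image_length \<sigma> p = Max (range (\<lambda>a. length ((subst_word \<sigma> ^^ p) [a])))"

definition subst_matrix :: "('a::finite \<Rightarrow> 'a list) \<Rightarrow> real ^ 'a ^ 'a" where
  "subst_matrix \<sigma> = (\<chi> a b. real (count_list (\<sigma> a) b))"

definition complex_eigenvalue :: "real ^ 'a ^ 'a \<Rightarrow> complex \<Rightarrow> bool" where
  "complex_eigenvalue M \<mu> \<longleftrightarrow>
     (\<exists>v. v \<noteq> 0 \<and> map_matrix complex_of_real M *v v = \<mu> *s v)"

text \<open>The Perron eigenvalue is the real eigenvalue equal to the spectral radius; this determines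
  it uniquely, and it exists for every nonnegative matrix.\<close>

definition perron_eigenvalue :: "real ^ 'a ^ 'a \<Rightarrow> real \<Rightarrow> bool" where
  "perron_eigenvalue M l \<longleftrightarrow>
     complex_eigenvalue M (complex_of_real l) \<and>
     (\<forall>\<mu>. complex_eigenvalue M \<mu> \<longrightarrow> cmod \<mu> \<le> l)"

definition positive_right_eigenvector :: "real ^ 'a ^ 'a \<Rightarrow> real \<Rightarrow> real ^ 'a \<Rightarrow> bool" where
  "positive_right_eigenvector M l \<beta> \<longleftrightarrow> (\<forall>a. 0 < \<beta> $ a) \<and> M *v \<beta> = l *s \<beta>"

definition const_C :: "real ^ 'a \<Rightarrow> nat" where
  "const_C \<beta> = nat \<lceil>Max (range (\<lambda>b. \<beta> $ b)) / Min (range (\<lambda>b. \<beta> $ b))\<rceil>"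

definition factors2 :: "(nat \<Rightarrow> 'a) \<Rightarrow> 'a list set" where
  "factors2 u = {w. \<exists>i. w = factor u i (i + 2)}"

definition gap :: "(nat \<Rightarrow> 'a) \<Rightarrow> 'a list \<Rightarrow> nat" where
  "gap u w = (LEAST g. 1 \<le> g \<and> (\<forall>k. \<exists>i\<in>{k..<k + g}. factor u i (i + 2) = w))"

definition max_gap :: "(nat \<Rightarrow> 'a) \<Rightarrow> nat" where
  "max_gap u = Max (gap u ` factors2 u)"

definition const_K :: "real \<Rightarrow> real ^ 'a \<Rightarrow> (nat \<Rightarrow> 'a::finite) \<Rightarrow> nat" where
  "const_K l \<beta> u =
     nat \<lceil>l * real (const_C \<beta>) ^ 2 * real (max (2 * (max_gap u + 1)) (CARD('a) ^ 2))\<rceil>"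

definition cut_points :: "('a \<Rightarrow> 'a list) \<Rightarrow> (nat \<Rightarrow> 'a) \<Rightarrow> nat set" where
  "cut_points \<sigma> u = {0} \<union> {length (subst_word \<sigma> (factor u 0 n)) |n. 1 \<le> n}"

definition bilaterally_recognizable :: "('a \<Rightarrow> 'a list) \<Rightarrow> (nat \<Rightarrow> 'a) \<Rightarrow> nat \<Rightarrow> bool" where
  "bilaterally_recognizable \<sigma> u L \<longleftrightarrow> 1 \<le> L \<and>
     (\<forall>i j. L \<le> i \<longrightarrow> L \<le> j \<longrightarrow> factor u (i - L) (i + L) = factor u (j - L) (j + L) \<longrightarrow>
        i \<in> cut_points \<sigma> u \<longrightarrow> j \<in> cut_points \<sigma> u)"

definition local_unique_composition :: "('a \<Rightarrow> 'a list) \<Rightarrow> (nat \<Rightarrow> 'a) \<Rightarrow> nat \<Rightarrow> bool" where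
  "local_unique_composition \<sigma> u L \<longleftrightarrow> bilaterally_recognizable \<sigma> u L \<and>
     (\<forall>i j m n. L \<le> i \<longrightarrow> L \<le> j \<longrightarrow> factor u (i - L) (i + L) = factor u (j - L) (j + L) \<longrightarrow>
        length (subst_word \<sigma> (factor u 0 m)) \<le> i \<longrightarrow>
        i < length (subst_word \<sigma> (factor u 0 (m + 1))) \<longrightarrow>
        length (subst_word \<sigma> (factor u 0 n)) \<le> j \<longrightarrow>
        j < length (subst_word \<sigma> (factor u 0 (n + 1))) \<longrightarrow>
        u m = u n)"

end

theory Submission
  imports Defs
begin

text \<open>
  The proof is a quantitative form of Mosse's pigeonhole argument. For each level \<open>p\<close> the
  fixed point \<open>u\<close> is a concatenation of blocks \<open>\<sigma>\<^sup>p(u\<^sub>n)\<close>, and the block of index \<open>n\<close> begins at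
  \<open>cut p n\<close>. Suppose the windows of radius \<open>L\<^sub>0\<close> around \<open>i\<close> and \<open>j\<close> agree. At every level
  \<open>p \<le> p\<^sub>0\<close> let \<open>v\<^sub>p\<close> be the word of length \<open>Q = C\<^sup>4(K+1) + 2C\<^sup>2 + 1\<close> in \<open>u\<close> whose image starts
  with the block containing \<open>i\<close>. Since \<open>\<sigma>\<^sup>p(v\<^sub>p)\<close> lies inside the window of \<open>i\<close>, it also
  occurs around \<open>j\<close>, where it is covered by a shortest image \<open>\<sigma>\<^sup>p(w\<^sub>p)\<close> of a factor \<open>w\<^sub>p\<close> of \<open>u\<close>.
  Images of two letters at the same level have lengths within a factor \<open>C\<^sup>2\<close>, which confines the
  length of \<open>w\<^sub>p\<close> to the range of summation in \<open>p\<^sub>0\<close>; and \<open>u\<close> has at most \<open>K n\<close> factors of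
  length \<open>n\<close> (\<open>card_words_le\<close>). So there are at most \<open>p\<^sub>0 - 1\<close> pairs \<open>(v\<^sub>p, w\<^sub>p)\<close>, and two levels
  \<open>p < q\<close> have the same pair \<open>(v, w)\<close>.

  Now \<open>\<sigma>\<^sup>q(w)\<close> contains \<open>\<sigma>\<^sup>q(v)\<close> in two ways: as the copy found around \<open>j\<close> at level \<open>q\<close>, and as
  the image under \<open>\<sigma>\<^sup>q\<^sup>-\<^sup>p\<close> of the copy found at level \<open>p\<close>. Both start in the first block of
  \<open>\<sigma>\<^sup>q(w)\<close>. If they were different, \<open>\<sigma>\<^sup>q(v)\<close> would have a period \<open>d\<close> with \<open>K d \<le> |\<sigma>\<^sup>q(v)|\<close>; but a
  factor that long contains every factor of \<open>u\<close> of length \<open>d + 1\<close>, and then \<open>u\<close> itself would have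
  period \<open>d\<close> (\<open>no_long_repetition\<close>). So the two copies coincide, and the copy around \<open>j\<close> is the
  image under \<open>\<sigma>\<^sup>q\<^sup>-\<^sup>p\<close> of a factor of \<open>u\<close>. As \<open>q > p\<close>, it is in particular the image under \<open>\<sigma>\<close>
  of an occurrence of \<open>\<sigma>\<^sup>q\<^sup>-\<^sup>1(v)\<close>. The same holds around \<open>i\<close>, so the decompositions of \<open>u\<close>
  into images of letters around \<open>i\<close> and around \<open>j\<close> are translates of each other and come from
  the same letters (\<open>coverings_align\<close>). This gives at once that cutting points are recognized and
  that the letters above \<open>i\<close> and \<open>j\<close> agree.
\<close>

section \<open>Images of words and cutting points\<close>

lemma length_factor [simp]: "length (factor u i j) = j - i"
  by (simp add: factor_def)

lemma nth_factor [simp]: "t < j - i \<Longrightarrow> factor u i j ! t = u (i + t)"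
  by (simp add: factor_def)

lemma factor_append: "i \<le> j \<Longrightarrow> j \<le> k \<Longrightarrow> factor u i k = factor u i j @ factor u j k"
  unfolding factor_def by (metis map_append upt_add_eq_append le_Suc_ex)

lemma factor_Suc: "factor u i (Suc i) = [u i]"
  by (simp add: factor_def)

lemma factor_eq_iff:
  "factor u a (a + h) = factor u b (b + h) \<longleftrightarrow> (\<forall>t<h. u (a + t) = u (b + t))"
  by (auto simp: list_eq_iff_nth_eq)

lemma factor_eqD:
  assumes "factor u a a' = factor u b b'" "t < a' - a"
  shows "u (a + t) = u (b + t)"
proof -
  have "t < b' - b" using assms(2) arg_cong[OF assms(1), of length] by simp
  then show ?thesis using assms(2) arg_cong[OF assms(1), of "\<lambda>w. w ! t"] by simp
qed

lemma subst_word_append [simp]: "subst_word \<sigma> (v @ w) = subst_word \<sigma> v @ subst_word \<sigma> w"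
  by (simp add: subst_word_def)

lemma subst_iter_append:
  "(subst_word \<sigma> ^^ p) (v @ w) = (subst_word \<sigma> ^^ p) v @ (subst_word \<sigma> ^^ p) w"
  by (induction p) auto

lemma subst_iter_Nil [simp]: "(subst_word \<sigma> ^^ p) [] = []"
  by (induction p) (auto simp: subst_word_def)

lemma shift_seq_iter: "(shift_seq ^^ d) u = (\<lambda>i. u (i + d))"
  by (induction d) (auto simp: shift_seq_def)

lemma length_subst_word_ge:
  assumes "\<And>a. \<sigma> a \<noteq> []"
  shows "length w \<le> length (subst_word \<sigma> w)"
proof (induction w)
  case (Cons a w)
  have "1 \<le> length (\<sigma> a)" using assms[of a] by (cases "\<sigma> a") auto
  then show ?case using Cons by (simp add: subst_word_def)
qed simp

definition min_image_length :: "('a::finite \<Rightarrow> 'a list) \<Rightarrow> nat \<Rightarrow> nat" where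
  "min_image_length \<sigma> p = Min (range (\<lambda>a. length ((subst_word \<sigma> ^^ p) [a])))"

lemma image_length_le_max: "length ((subst_word \<sigma> ^^ p) [a]) \<le> max_image_length \<sigma> p"
  for \<sigma> :: "'a::finite \<Rightarrow> 'a list"
  unfolding max_image_length_def by (intro Max_ge) auto

lemma min_le_image_length: "min_image_length \<sigma> p \<le> length ((subst_word \<sigma> ^^ p) [a])"
  unfolding min_image_length_def by (intro Min_le) auto

lemma max_image_length_attained:
  obtains a where "max_image_length \<sigma> p = length ((subst_word \<sigma> ^^ p) [a])"
proof -
  have "max_image_length \<sigma> p \<in> range (\<lambda>a. length ((subst_word \<sigma> ^^ p) [a]))"
    unfolding max_image_length_def by (rule Max_in) auto
  then show ?thesis using that by blast
qed

lemma min_image_length_attained: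
  obtains a where "min_image_length \<sigma> p = length ((subst_word \<sigma> ^^ p) [a])"
proof -
  have "min_image_length \<sigma> p \<in> range (\<lambda>a. length ((subst_word \<sigma> ^^ p) [a]))"
    unfolding min_image_length_def by (rule Min_in) auto
  then show ?thesis using that by blast
qed

locale fixed_point =
  fixes \<sigma> :: "'a::finite \<Rightarrow> 'a list" and u :: "nat \<Rightarrow> 'a"
  assumes image_nonempty: "substitution \<sigma>" and fixed: "subst_seq \<sigma> u = u"
begin

abbreviation img :: "nat \<Rightarrow> 'a list \<Rightarrow> 'a list" where
  "img p w \<equiv> (subst_word \<sigma> ^^ p) w"

definition cut :: "nat \<Rightarrow> nat \<Rightarrow> nat" where
  "cut p n = length (img p (factor u 0 n))"

lemma length_subst_word: "length w \<le> length (subst_word \<sigma> w)"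
  using image_nonempty length_subst_word_ge unfolding substitution_def by blast

lemma length_img: "length w \<le> length (img p w)"
  by (induction p) (auto intro: order_trans[OF _ length_subst_word])

text \<open>The fixed point equation compares single letters; on prefixes it says that \<open>\<sigma>\<close> maps
  prefixes of \<open>u\<close> to prefixes of \<open>u\<close>.\<close>

lemma subst_prefix:
  "subst_word \<sigma> (factor u 0 n) = factor u 0 (length (subst_word \<sigma> (factor u 0 n)))"
proof (rule nth_equalityI)
  fix i assume i: "i < length (subst_word \<sigma> (factor u 0 n))"
  let ?A = "subst_word \<sigma> (factor u 0 n)" and ?B = "subst_word \<sigma> (factor u 0 (Suc i))"
  have "i < length ?B" using length_subst_word[of "factor u 0 (Suc i)"] by simp
  then have "?A ! i = ?B ! i"
    using i factor_append[of 0 "Suc i" n u] factor_append[of 0 n "Suc i" u]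
    by (cases "Suc i \<le> n") (auto simp: nth_append)
  also have "\<dots> = u i" using fun_cong[OF fixed, of i] by (simp add: subst_seq_def)
  finally show "?A ! i = factor u 0 (length ?A) ! i" using i by simp
qed simp

lemma img_prefix: "img p (factor u 0 n) = factor u 0 (cut p n)"
proof (induction p)
  case (Suc p)
  have "img (Suc p) (factor u 0 n) = subst_word \<sigma> (factor u 0 (cut p n))"
    using Suc by simp
  moreover from this have "cut (Suc p) n = length (subst_word \<sigma> (factor u 0 (cut p n)))"
    by (simp only: cut_def)
  ultimately show ?case using subst_prefix by metis
qed (simp add: cut_def)

text \<open>Blocks of level \<open>p + q\<close> are images under \<open>\<sigma>\<^sup>p\<close> of blocks of level \<open>q\<close>, so moving up
  \<open>p\<close> levels is the map \<open>cut p\<close> on positions.\<close>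

lemma cut_add: "cut (p + q) n = cut p (cut q n)"
proof -
  have "cut (p + q) n = length (img p (img q (factor u 0 n)))"
    by (simp add: cut_def funpow_add)
  also have "\<dots> = cut p (cut q n)"
    unfolding img_prefix[of q] by (simp only: cut_def[of p])
  finally show ?thesis .
qed

lemma cut_split: "a \<le> b \<Longrightarrow> cut p b = cut p a + length (img p (factor u a b))"
  using factor_append[of 0 a b u] by (simp add: cut_def subst_iter_append)

lemma cut_mono: "a \<le> b \<Longrightarrow> cut p a \<le> cut p b"
  by (simp add: cut_split)

lemma cut_0 [simp]: "cut p 0 = 0"
  by (simp add: cut_def factor_def)

lemma cut_Suc: "cut p (Suc n) = cut p n + length (img p [u n])"
  using cut_split[of n "Suc n" p] by (simp add: factor_Suc)

lemma img_factor:
  assumes "a \<le> b"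
  shows "img p (factor u a b) = factor u (cut p a) (cut p b)"
proof -
  have "factor u 0 (cut p a) @ img p (factor u a b) = img p (factor u 0 b)"
    using assms factor_append[of 0 a b u] by (simp add: img_prefix[symmetric] subst_iter_append)
  also have "\<dots> = factor u 0 (cut p a) @ factor u (cut p a) (cut p b)"
    unfolding img_prefix using factor_append cut_mono[OF assms] by blast
  finally show ?thesis by simp
qed

lemma img_letter_pos: "0 < length (img p [a])"
  using length_img[of "[a]" p] by (simp only: length_Cons)

lemma cut_ge: "n \<le> cut p n"
  using length_img[of "factor u 0 n" p] by (simp add: cut_def)

lemma cut_locate: obtains m where "cut p m \<le> i" "i < cut p (Suc m)"
proof -
  let ?N = "LEAST n. i < cut p n"
  have *: "i < cut p ?N" by (rule LeastI[of _ "Suc i"]) (use cut_ge[of "Suc i" p] in simp)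
  then obtain m where m: "?N = Suc m" by (cases ?N) auto
  then have "\<not> i < cut p m" by (intro not_less_Least) simp
  with * m show ?thesis by (intro that[of m]) auto
qed

lemma cut_upper: "cut p (a + t) \<le> cut p a + t * max_image_length \<sigma> p"
proof (induction t)
  case (Suc t)
  show ?case using Suc image_length_le_max[where a = "u (a + t)" and \<sigma> = \<sigma> and p = p]
    by (simp add: cut_Suc)
qed simp

lemma cut_lower: "cut p a + t * min_image_length \<sigma> p \<le> cut p (a + t)"
proof (induction t)
  case (Suc t)
  show ?case using Suc min_le_image_length[where a = "u (a + t)" and \<sigma> = \<sigma> and p = p]
    by (simp add: cut_Suc)
qed simp

text \<open>Equal words have equal images: this is what transports an equality of factors from one
  level of the hierarchy to the next.\<close>

lemma transport_cut:
  assumes "factor u a (a + h) = factor u b (b + h)" "t \<le> h"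
  shows "cut p (a + t) + cut p b = cut p (b + t) + cut p a"
proof -
  have "factor u a (a + t) = factor u b (b + t)"
    using assms unfolding factor_eq_iff by auto
  then show ?thesis by (simp add: cut_split[of a "a + t"] cut_split[of b "b + t"])
qed

lemma transport_factor:
  assumes "factor u a (a + h) = factor u b (b + h)"
  shows "factor u (cut p a) (cut p (a + h)) = factor u (cut p b) (cut p (b + h))"
  using assms by (simp add: img_factor[symmetric])

lemma min_image_length_pos: "0 < min_image_length \<sigma> p"
  by (metis min_image_length_attained img_letter_pos)

lemma max_image_length_mono: "p \<le> q \<Longrightarrow> max_image_length \<sigma> p \<le> max_image_length \<sigma> q"
proof (induction q rule: dec_induct)
  case (step q)
  obtain a where "max_image_length \<sigma> q = length (img q [a])"
    by (rule max_image_length_attained)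
  also have "\<dots> \<le> length (img (Suc q) [a])" by (simp add: length_subst_word)
  also have "\<dots> \<le> max_image_length \<sigma> (Suc q)" by (rule image_length_le_max)
  finally show ?case using step by simp
qed simp

end

section \<open>Growth of the images of letters\<close>

locale primitive_aperiodic = fixed_point \<sigma> u
  for \<sigma> :: "'a::finite \<Rightarrow> 'a list" and u :: "nat \<Rightarrow> 'a" +
  fixes l :: real and \<beta> :: "real ^ 'a"
  assumes two_letters: "2 \<le> CARD('a)"
    and primitive: "primitive_subst \<sigma>"
    and aperiodic: "aperiodic_seq u"
    and eigenvector: "positive_right_eigenvector (subst_matrix \<sigma>) l \<beta>"
begin

abbreviation C :: nat where "C \<equiv> const_C \<beta>"
abbreviation K :: nat where "K \<equiv> const_K l \<beta> u"

text \<open>The eigenvector equation says that \<open>\<sigma>\<close> multiplies this weight by \<open>l\<close>. As the weight and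
  the length of a word differ by bounded factors, the lengths of \<open>\<sigma>\<^sup>p\<close> on letters are comparable
  with \<open>l\<^sup>p\<close>.\<close>

definition weight :: "'a list \<Rightarrow> real" where
  "weight w = (\<Sum>a\<leftarrow>w. \<beta> $ a)"

lemma beta_pos: "0 < \<beta> $ a"
  using eigenvector by (simp add: positive_right_eigenvector_def)

lemma weight_letter_image: "weight (\<sigma> a) = l * \<beta> $ a"
proof -
  have "(subst_matrix \<sigma> *v \<beta>) $ a = (l *s \<beta>) $ a"
    using eigenvector by (simp add: positive_right_eigenvector_def)
  then have "(\<Sum>b\<in>UNIV. real (count_list (\<sigma> a) b) * \<beta> $ b) = l * \<beta> $ a"
    by (simp add: matrix_vector_mult_def subst_matrix_def)
  moreover have "weight w = (\<Sum>b\<in>UNIV. real (count_list w b) * \<beta> $ b)" for w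
  proof (induction w)
    case (Cons a w)
    have "(\<Sum>b\<in>UNIV. real (count_list (a # w) b) * \<beta> $ b) =
        (\<Sum>b\<in>UNIV. (if b = a then \<beta> $ b else 0) + real (count_list w b) * \<beta> $ b)"
      by (intro sum.cong) (auto simp: algebra_simps)
    then show ?case using Cons by (simp add: weight_def sum.distrib)
  qed (simp add: weight_def)
  ultimately show ?thesis by simp
qed

lemma weight_img: "weight (img p w) = l ^ p * weight w"
proof -
  have "weight (subst_word \<sigma> w) = l * weight w" for w
  proof (induction w)
    case (Cons a w)
    have "weight (subst_word \<sigma> (a # w)) = weight (\<sigma> a) + weight (subst_word \<sigma> w)"
      by (simp add: weight_def subst_word_def)
    then show ?case using Cons weight_letter_image[of a]
      by (simp add: weight_def algebra_simps)
  qed (simp add: weight_def subst_word_def)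
  then show ?thesis by (induction p) auto
qed

lemma C_bounds:
  obtains c where "\<And>a. \<beta> $ c \<le> \<beta> $ a" "\<And>a. \<beta> $ a \<le> real C * \<beta> $ c"
proof -
  have "Min (range (($) \<beta>)) \<in> range (($) \<beta>)" by (rule Min_in) auto
  then obtain c where c: "Min (range (($) \<beta>)) = \<beta> $ c" by (rule imageE)
  have lo: "\<beta> $ c \<le> \<beta> $ a" for a unfolding c[symmetric] by (rule Min_le) auto
  have "\<beta> $ a \<le> real C * \<beta> $ c" for a
  proof -
    have "\<beta> $ a \<le> Max (range (($) \<beta>))" by (rule Max_ge) auto
    moreover have "Max (range (($) \<beta>)) / \<beta> $ c \<le> real C"
      unfolding const_C_def c by linarith
    ultimately show ?thesis using beta_pos[of c] by (auto simp: pos_divide_le_eq)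
  qed
  with lo that show ?thesis by blast
qed

lemma C_pos: "1 \<le> C"
proof -
  obtain c where "\<beta> $ c \<le> real C * \<beta> $ c" using C_bounds by metis
  then show ?thesis using beta_pos[of c] by (cases C) auto
qed

lemma image_length_bounds:
  "real (length (img p [a])) \<le> real C * l ^ p" "l ^ p \<le> real C * real (length (img p [a]))"
    and eigenvalue_ge_1: "1 \<le> l"
proof -
  obtain c where c: "\<And>a. \<beta> $ c \<le> \<beta> $ a" "\<And>a. \<beta> $ a \<le> real C * \<beta> $ c"
    using C_bounds by metis
  have low: "\<beta> $ c * real (length w) \<le> weight w" for w
    by (induction w) (use c(1) in \<open>auto simp: weight_def algebra_simps intro: add_mono\<close>)
  have high: "weight w \<le> real C * \<beta> $ c * real (length w)" for w
    by (induction w) (use c(2) in \<open>auto simp: weight_def algebra_simps intro: add_mono\<close>)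
  have W: "weight (img p [a]) = l ^ p * \<beta> $ a" for p a
    by (simp add: weight_img) (simp add: weight_def)
  have gen: "\<beta> $ c \<le> l ^ p * \<beta> $ a" for p a
  proof -
    have "1 \<le> real (length (img p [a]))" using img_letter_pos[of p a] by linarith
    then have "\<beta> $ c * 1 \<le> \<beta> $ c * real (length (img p [a]))"
      using beta_pos[of c] by (intro mult_left_mono) auto
    then show ?thesis using low[of "img p [a]"] W by simp
  qed
  have "\<beta> $ c * 1 \<le> \<beta> $ c * l" using gen[of 1 c] by (simp add: mult.commute)
  then show "1 \<le> l" using beta_pos[of c] mult_le_cancel_left_pos by blast
  then have lp: "0 < l ^ p" by simp
  have "\<beta> $ c * real (length (img p [a])) \<le> l ^ p * \<beta> $ a" using low W by metis
  also have "\<dots> \<le> l ^ p * (real C * \<beta> $ c)"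
    using lp c(2)[of a] by (intro mult_left_mono) auto
  finally show "real (length (img p [a])) \<le> real C * l ^ p"
    using beta_pos[of c] by (simp add: mult.commute mult.left_commute)
  have "\<beta> $ c * l ^ p \<le> l ^ p * \<beta> $ a" using c(1)[of a] lp by simp
  also have "\<dots> \<le> real C * \<beta> $ c * real (length (img p [a]))" using high W by metis
  finally show "l ^ p \<le> real C * real (length (img p [a]))"
    using beta_pos[of c] by (simp add: mult.commute mult.left_commute)
qed

lemma max_le_eigen_min:
  "real (max_image_length \<sigma> p) \<le> real C ^ 2 * real (min_image_length \<sigma> p)"
  "real (max_image_length \<sigma> (Suc p)) \<le> l * real C ^ 2 * real (min_image_length \<sigma> p)"
proof -
  have *: "real (max_image_length \<sigma> q) \<le> real C * l ^ q" for q
    by (metis max_image_length_attained image_length_bounds(1))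
  have **: "real C * l ^ p \<le> real C * (real C * real (min_image_length \<sigma> p))"
    by (intro mult_left_mono) (metis min_image_length_attained image_length_bounds(2), simp)
  show "real (max_image_length \<sigma> p) \<le> real C ^ 2 * real (min_image_length \<sigma> p)"
    using order_trans[OF * **] by (simp only: power2_eq_square mult.assoc)
  have "real (max_image_length \<sigma> (Suc p)) \<le> l * (real C * l ^ p)"
    using *[of "Suc p"] by (simp add: mult.left_commute)
  also have "\<dots> \<le> l * (real C * (real C * real (min_image_length \<sigma> p)))"
    using eigenvalue_ge_1 by (intro mult_left_mono[OF **]) simp
  finally show "real (max_image_length \<sigma> (Suc p)) \<le> l * real C ^ 2 * real (min_image_length \<sigma> p)"
    by (simp add: power2_eq_square mult.assoc)
qed

lemma max_le_min: "max_image_length \<sigma> p \<le> C ^ 2 * min_image_length \<sigma> p"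
  using max_le_eigen_min(1)[of p]
  by (metis of_nat_le_iff of_nat_mult of_nat_power)

lemma min_image_length_unbounded: "\<exists>k. n \<le> min_image_length \<sigma> k"
proof -
  obtain k where k: "\<And>a b. a \<in> set (img k [b])"
    using primitive unfolding primitive_subst_def by blast
  have two: "2 \<le> length (img k [b])" for b
  proof -
    have "set (img k [b]) = UNIV" using k by auto
    then show ?thesis using card_length[of "img k [b]"] two_letters by simp
  qed
  have dbl: "2 * length w \<le> length (img k w)" for w
  proof (induction w)
    case (Cons a w)
    have "img k (a # w) = img k [a] @ img k w" using subst_iter_append[of k \<sigma> "[a]" w] by simp
    then show ?case using Cons two[of a] by simp
  qed simp
  have "2 ^ n \<le> length (img (k * n) [a])" for n a
  proof (induction n)
    case (Suc n)
    have "2 ^ Suc n \<le> 2 * length (img (k * n) [a])" using Suc by simp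
    also have "\<dots> \<le> length (img k (img (k * n) [a]))" by (rule dbl)
    finally show ?case by (simp add: funpow_add)
  qed simp
  then have "2 ^ n \<le> min_image_length \<sigma> (k * n)" by (metis min_image_length_attained)
  moreover have "n \<le> 2 ^ n" by simp
  ultimately show ?thesis using order_trans by blast
qed

text \<open>The least level whose blocks all have length at least \<open>n\<close>. Going up one level
  multiplies lengths by roughly \<open>l\<close>, so its blocks are not much longer than \<open>n\<close>; at level 0
  the bound holds because \<open>l\<close> and \<open>C\<close> are at least 1.\<close>

lemma level_for_length:
  assumes "1 \<le> n"
  obtains k where "n \<le> min_image_length \<sigma> k"
    "real (max_image_length \<sigma> k) \<le> l * real C ^ 2 * real n"
proof -
  define k where "k = (LEAST k. n \<le> min_image_length \<sigma> k)"
  have k: "n \<le> min_image_length \<sigma> k" unfolding k_def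
    using min_image_length_unbounded by (rule LeastI_ex)
  have lC: "1 \<le> l * real C ^ 2"
    using eigenvalue_ge_1 C_pos mult_mono[of 1 l 1 "real C ^ 2"] by simp
  have "real (max_image_length \<sigma> k) \<le> l * real C ^ 2 * real n"
  proof (cases k)
    case 0
    have "max_image_length \<sigma> k = 1" by (simp add: max_image_length_def 0)
    moreover have "1 * 1 \<le> l * real C ^ 2 * real n" using lC assms by (intro mult_mono) auto
    ultimately show ?thesis by simp
  next
    case (Suc k')
    then have "\<not> n \<le> min_image_length \<sigma> k'"
      unfolding k_def by (intro not_less_Least) simp
    then have "real (min_image_length \<sigma> k') \<le> real n" by simp
    then have "l * real C ^ 2 * real (min_image_length \<sigma> k') \<le> l * real C ^ 2 * real n"
      using lC by (intro mult_left_mono) auto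
    then show ?thesis using max_le_eigen_min(2)[of k'] unfolding Suc by linarith
  qed
  with k that show ?thesis by blast
qed

lemma K_ge: "l * real C ^ 2 * real (CARD('a) ^ 2) \<le> real K"
  "l * real C ^ 2 * real (2 * (max_gap u + 1)) \<le> real K"
proof -
  let ?m = "max (2 * (max_gap u + 1)) (CARD('a) ^ 2)"
  have "l * real C ^ 2 * real ?m \<le> real K" unfolding const_K_def by linarith
  moreover have "l * real C ^ 2 * real x \<le> l * real C ^ 2 * real ?m" if "x \<le> ?m" for x
    using that eigenvalue_ge_1 by (intro mult_left_mono) auto
  ultimately show "l * real C ^ 2 * real (CARD('a) ^ 2) \<le> real K"
    "l * real C ^ 2 * real (2 * (max_gap u + 1)) \<le> real K"
    by (meson max.cobounded1 max.cobounded2 order_trans)+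
qed

section \<open>Complexity, recurrence and repetitions\<close>

lemma locate_in_two_blocks:
  assumes "n \<le> min_image_length \<sigma> k"
  obtains m t where "i = cut k m + t" "t < max_image_length \<sigma> k" "i + n < cut k (m + 2)"
proof -
  obtain m where m: "cut k m \<le> i" "i < cut k (Suc m)" by (rule cut_locate)
  show ?thesis
  proof (rule that)
    show "i = cut k m + (i - cut k m)" using m by simp
    show "i - cut k m < max_image_length \<sigma> k"
      using m cut_upper[of k m 1] by simp
    show "i + n < cut k (m + 2)"
      using m assms cut_lower[of k "Suc m" 1] by simp
  qed
qed

definition words :: "nat \<Rightarrow> 'a list set" where
  "words n = range (\<lambda>i. factor u i (i + n))"

lemma finite_words: "finite (words n)"
  by (rule finite_subset[OF _ finite_lists_length_eq[of UNIV n]]) (auto simp: words_def)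

text \<open>At a level with blocks of length at least \<open>n\<close>, a factor of length \<open>n\<close> is determined by
  two consecutive letters and by its offset in the first of their two blocks.\<close>

lemma card_words_le:
  assumes "1 \<le> n"
  shows "card (words n) \<le> K * n"
proof -
  obtain k where k: "n \<le> min_image_length \<sigma> k"
    "real (max_image_length \<sigma> k) \<le> l * real C ^ 2 * real n"
    using level_for_length[OF assms] by blast
  let ?P = "{w :: 'a list. set w \<subseteq> UNIV \<and> length w = 2} \<times> {..<max_image_length \<sigma> k}"
  have fin: "finite ?P" by (intro finite_cartesian_product finite_lists_length_eq) auto
  have sub: "words n \<subseteq> (\<lambda>(w, t). take n (drop t (img k w))) ` ?P"
  proof
    fix x assume "x \<in> words n"
    then obtain i where x: "x = factor u i (i + n)" by (auto simp: words_def)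
    obtain m t where mt: "i = cut k m + t" "t < max_image_length \<sigma> k" "i + n < cut k (m + 2)"
      using locate_in_two_blocks[OF k(1)] by blast
    have "x = take n (drop t (img k (factor u m (m + 2))))"
      unfolding img_factor[OF le_add1] x using mt
      by (intro nth_equalityI) (auto simp: add.assoc)
    then show "x \<in> (\<lambda>(w, t). take n (drop t (img k w))) ` ?P"
      using mt(2) by (intro image_eqI[of _ _ "(factor u m (m + 2), t)"]) auto
  qed
  have "card (words n) \<le> card ?P"
    using surj_card_le[OF fin sub] .
  also have "\<dots> = CARD('a) ^ 2 * max_image_length \<sigma> k"
    using card_lists_length_eq[of "UNIV :: 'a set" 2] by (simp add: card_cartesian_product)
  finally have "real (card (words n)) \<le> real (CARD('a) ^ 2) * real (max_image_length \<sigma> k)"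
    by (metis of_nat_le_iff of_nat_mult)
  also have "\<dots> \<le> real (CARD('a) ^ 2) * (l * real C ^ 2 * real n)"
    using k(2) by (intro mult_left_mono) auto
  also have "\<dots> = l * real C ^ 2 * real (CARD('a) ^ 2) * real n" by simp
  also have "\<dots> \<le> real K * real n" by (intro mult_right_mono K_ge(1)) simp
  finally show ?thesis by (metis of_nat_le_iff of_nat_mult)
qed

text \<open>The word occurs in \<open>\<sigma>\<^sup>q(u\<^sub>0)\<close> for large \<open>q\<close>, and \<open>u\<^sub>0\<close> occurs in \<open>\<sigma>\<^sup>r(b)\<close> for every letter
  \<open>b\<close> by primitivity, so the word occurs in every block of level \<open>q + r\<close>. This guarantees that
  the least element in the definition of \<open>gap\<close> exists.\<close>

lemma bounded_gap: "\<exists>g\<ge>1. \<forall>k. \<exists>i\<in>{k..<k + g}. factor u i (i + 2) = factor u j (j + 2)"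
proof -
  obtain q where q: "j + 2 \<le> min_image_length \<sigma> q" using min_image_length_unbounded by blast
  obtain r where r: "\<And>a b. a \<in> set (img r [b])"
    using primitive unfolding primitive_subst_def by blast
  let ?n = "q + r"
  have "\<exists>i\<in>{k..<k + 2 * max_image_length \<sigma> ?n}. factor u i (i + 2) = factor u j (j + 2)" for k
  proof -
    obtain m where m: "cut ?n m \<le> k" "k < cut ?n (Suc m)" by (rule cut_locate)
    have "u 0 \<in> set (img r (factor u (Suc m) (Suc (Suc m))))"
      using r by (simp add: factor_Suc)
    then have "u 0 \<in> set (factor u (cut r (Suc m)) (cut r (Suc (Suc m))))"
      by (simp add: img_factor)
    then obtain z where z: "cut r (Suc m) \<le> z" "z < cut r (Suc (Suc m))" "u z = u 0"
      by (auto simp: factor_def)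
    have "factor u z (z + 1) = factor u 0 (0 + 1)" by (simp add: factor_Suc z(3))
    from transport_factor[OF this, of q] transport_cut[OF this order_refl, of q]
    have eq: "factor u (cut q z) (cut q z + cut q 1) = factor u 0 (0 + cut q 1)"
      by (simp add: add.commute)
    have "j + 2 \<le> cut q 1" using q cut_lower[of q 0 1] by simp
    with eq have "factor u (cut q z + j) (cut q z + j + 2) = factor u j (j + 2)"
      unfolding factor_eq_iff by (auto simp: add.assoc)
    moreover have "k \<le> cut q z + j" using z(1) m(2) cut_mono[of "cut r (Suc m)" z q]
      by (simp add: cut_add)
    moreover have "cut q z + j < k + 2 * max_image_length \<sigma> ?n"
    proof -
      have "cut q z + j < cut q (Suc z)"
        using q cut_lower[of q z 1] by simp
      also have "\<dots> \<le> cut ?n (Suc (Suc m))" using z(2) by (simp add: cut_add cut_mono)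
      also have "\<dots> \<le> cut ?n m + 2 * max_image_length \<sigma> ?n" using cut_upper[of ?n m 2] by simp
      finally show ?thesis using m(1) by simp
    qed
    ultimately show ?thesis by (intro bexI[of _ "cut q z + j"]) auto
  qed
  moreover have "1 \<le> 2 * max_image_length \<sigma> ?n"
    using image_length_le_max[of ?n \<sigma> "u 0"] img_letter_pos[of ?n "u 0"] by linarith
  ultimately show ?thesis by blast
qed

lemma factors2_within_max_gap:
  obtains i where "k \<le> i" "i < k + max_gap u" "factor u i (i + 2) = factor u j (j + 2)"
proof -
  let ?w = "factor u j (j + 2)"
  have "\<forall>k. \<exists>i\<in>{k..<k + gap u ?w}. factor u i (i + 2) = ?w"
    unfolding gap_def using LeastI_ex[OF bounded_gap[of j, simplified]] by auto
  then obtain i where "k \<le> i" "i < k + gap u ?w" "factor u i (i + 2) = ?w"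
    by (meson atLeastLessThan_iff)
  moreover have "gap u ?w \<le> max_gap u"
    unfolding max_gap_def
  proof (rule Max_ge)
    have "factors2 u = words 2" by (auto simp: factors2_def words_def)
    then show "finite (gap u ` factors2 u)" using finite_words by simp
    show "gap u ?w \<in> gap u ` factors2 u" by (auto simp: factors2_def)
  qed
  ultimately show ?thesis using that by (meson add_left_mono order_less_le_trans)
qed

text \<open>Take a level whose blocks have length at least \<open>d\<close>, but not much more. Every pair of
  positions \<open>i, i + d\<close> lies in two consecutive blocks, and the corresponding pair of letters occurs
  within every \<open>max_gap u\<close> consecutive blocks. The repetition is long enough to contain \<open>max_gap u + 2\<close>
  such blocks, so the pair of positions has a copy inside it and \<open>u i = u (i + d)\<close>. As \<open>i\<close> is
  arbitrary, \<open>u\<close> would be periodic.\<close>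

lemma no_long_repetition:
  assumes "1 \<le> d" "K * d \<le> N"
    and per: "\<And>x. a \<le> x \<Longrightarrow> x + d < a + N \<Longrightarrow> u x = u (x + d)"
  shows False
proof -
  obtain k where k: "d \<le> min_image_length \<sigma> k"
    "real (max_image_length \<sigma> k) \<le> l * real C ^ 2 * real d"
    using level_for_length[OF assms(1)] by blast
  have "real (max_gap u + 2) * real (max_image_length \<sigma> k) \<le>
      real (2 * (max_gap u + 1)) * (l * real C ^ 2 * real d)"
    using k(2) by (intro mult_mono) auto
  also have "\<dots> = l * real C ^ 2 * real (2 * (max_gap u + 1)) * real d" by simp
  also have "\<dots> \<le> real K * real d" by (intro mult_right_mono K_ge(2)) simp
  finally have "(max_gap u + 2) * max_image_length \<sigma> k \<le> K * d"
    by (metis of_nat_le_iff of_nat_mult)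
  then have size: "(max_gap u + 2) * max_image_length \<sigma> k \<le> N" using assms(2) by simp
  have "u i = u (i + d)" for i
  proof -
    obtain m t where mt: "i = cut k m + t" "i + d < cut k (m + 2)"
      using locate_in_two_blocks[OF k(1)] by metis
    obtain r where r: "cut k r \<le> a" "a < cut k (Suc r)" by (rule cut_locate)
    obtain m' where m': "Suc r \<le> m'" "m' < Suc r + max_gap u"
      "factor u m' (m' + 2) = factor u m (m + 2)"
      by (rule factors2_within_max_gap)
    let ?x = "cut k m' + t"
    have len: "cut k (m' + 2) + cut k m = cut k (m + 2) + cut k m'"
      using transport_cut[OF m'(3) order_refl] .
    define h where "h = cut k (m + 2) - cut k m"
    have h: "cut k (m' + 2) = cut k m' + h" "cut k (m + 2) = cut k m + h"
      using len cut_mono[OF le_add1, of k m 2] unfolding h_def by linarith+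
    have eq: "u (cut k m' + y) = u (cut k m + y)" if "y < h" for y
      using transport_factor[OF m'(3), of k] that unfolding h factor_eq_iff by simp
    have "?x + d < cut k (m' + 2)" using mt h by simp
    also have "\<dots> \<le> cut k (r + (max_gap u + 2))" using m'(2) by (intro cut_mono) simp
    also have "\<dots> \<le> cut k r + (max_gap u + 2) * max_image_length \<sigma> k" by (rule cut_upper)
    also have "\<dots> \<le> a + N" using size r by linarith
    finally have "u ?x = u (?x + d)"
      using r(2) cut_mono[OF m'(1), of k] by (intro per) auto
    then show ?thesis using eq[of t] eq[of "t + d"] mt h by (simp add: add.assoc)
  qed
  then have "(shift_seq ^^ d) u = u" by (simp add: shift_seq_iter)
  then show False using aperiodic assms(1) by (auto simp: aperiodic_seq_def)
qed

lemma close_occurrences_coincide: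
  assumes eq: "factor u a (a + h) = factor u c (c + h)"
    and close: "a \<le> c" "K * (c - a) \<le> h"
  shows "a = c"
proof (rule ccontr)
  assume "a \<noteq> c"
  with close have d: "1 \<le> c - a" by simp
  show False
  proof (rule no_long_repetition[OF d, of "h + (c - a)" a])
    show "K * (c - a) \<le> h + (c - a)" using close by simp
    fix x assume "a \<le> x" "x + (c - a) < a + (h + (c - a))"
    moreover from this have "x - a < h" "a + (x - a) = x" "c + (x - a) = x + (c - a)"
      using close by auto
    ultimately show "u x = u (x + (c - a))"
      using eq unfolding factor_eq_iff by metis
  qed
qed

section \<open>Comparing two levels\<close>

text \<open>The number of consecutive blocks around \<open>i\<close> that are looked for around \<open>j\<close>. It equals
  \<open>C\<^sup>2(C\<^sup>2(K+1) + 2) + 1\<close>, so that \<open>Q\<close> blocks are longer than any \<open>C\<^sup>2(K+1) + 2\<close> blocks of the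
  same level.\<close>

definition Q :: nat where
  "Q = C ^ 4 * (K + 1) + 2 * C ^ 2 + 1"

lemma Q_pos: "1 \<le> Q"
  by (simp add: Q_def)

lemma KC2_le_Q: "K * C ^ 2 \<le> Q"
proof -
  have "K * C ^ 2 * 1 \<le> K * C ^ 2 * C ^ 2" using C_pos by (intro mult_left_mono) auto
  also have "\<dots> = K * C ^ 4" by (simp add: power4_eq_xxxx power2_eq_square)
  also have "\<dots> \<le> Q" by (simp add: Q_def algebra_simps)
  finally show ?thesis by simp
qed

text \<open>Here \<open>m\<close> is the index of the block of level \<open>p\<close> that contains \<open>i\<close>. The \<open>Q\<close> blocks
  starting with it recur after the translation by \<open>j - i\<close>, at a position \<open>a\<close> that is in the block of
  index \<open>s\<close>, and this copy is covered by the \<open>e\<close> blocks from there on. The translation is written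
  as \<open>a + i = cut p m + j\<close> to avoid truncated subtraction.\<close>

definition covering :: "nat \<Rightarrow> nat \<Rightarrow> nat \<Rightarrow> nat \<Rightarrow> nat \<Rightarrow> nat \<Rightarrow> bool" where
  "covering i j p m s e \<longleftrightarrow>
     (\<exists>a. a + i = cut p m + j \<and> cut p m \<le> i \<and> i < cut p (Suc m) \<and>
        cut p s \<le> a \<and> a < cut p (Suc s) \<and>
        a + (cut p (m + Q) - cut p m) \<le> cut p (s + e) \<and>
        factor u a (a + (cut p (m + Q) - cut p m)) =
          factor u (cut p m) (cut p m + (cut p (m + Q) - cut p m)))"

text \<open>Comparing lengths bounds \<open>e\<close>: the \<open>e\<close> blocks are together at least as long as \<open>Q\<close> shortest
  blocks, while all of them except the first and the last fit into the length of \<open>Q\<close> longest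
  blocks.\<close>

lemma covering_exists:
  assumes L: "Q * max_image_length \<sigma> p \<le> L" "L \<le> i" "L \<le> j"
    and window: "factor u (i - L) (i + L) = factor u (j - L) (j + L)"
  obtains m s e where "covering i j p m s e"
    "C ^ 2 * (K + 1) + 2 \<le> e" "e \<le> C ^ 2 * Q + 2"
proof -
  let ?S = "max_image_length \<sigma> p" and ?s = "min_image_length \<sigma> p"
  obtain m where m: "cut p m \<le> i" "i < cut p (Suc m)" by (rule cut_locate)
  define h where "h = cut p (m + Q) - cut p m"
  have h: "h \<le> Q * ?S" "Q * ?s \<le> h"
    unfolding h_def using cut_upper[of p m Q] cut_lower[of p m Q] by linarith+
  have SL: "?S \<le> L" using L(1) mult_le_mono1[OF Q_pos, of ?S] by linarith
  have near: "i < cut p m + ?S" using m cut_upper[of p m 1] by simp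
  define a where "a = cut p m + j - i"
  have a: "a + i = cut p m + j" using near SL L(3) unfolding a_def by linarith
  have win: "u (i - L + t) = u (j - L + t)" if "t < 2 * L" for t
    using that L(2) by (intro factor_eqD[OF window]) linarith
  have eq: "factor u a (a + h) = factor u (cut p m) (cut p m + h)"
    unfolding factor_eq_iff
  proof (intro allI impI)
    fix t assume t: "t < h"
    \<comment> \<open>the position \<open>cut p m + t\<close>, counted from the left end \<open>i - L\<close> of the window\<close>
    have "u (i - L + (cut p m + t + L - i)) = u (j - L + (cut p m + t + L - i))"
      using t h L near SL m by (intro win) linarith
    moreover have "i - L + (cut p m + t + L - i) = cut p m + t" using near SL L by linarith
    moreover have "j - L + (cut p m + t + L - i) = a + t" using near SL L a by linarith
    ultimately show "u (a + t) = u (cut p m + t)" by simp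
  qed
  obtain s where s: "cut p s \<le> a" "a < cut p (Suc s)" by (rule cut_locate)
  define e where "e = (LEAST e. a + h \<le> cut p (s + e))"
  have e: "a + h \<le> cut p (s + e)" unfolding e_def
    by (rule LeastI[of _ "a + h"]) (use cut_ge[of "s + (a + h)" p] in simp)
  have spos: "0 < ?s" by (rule min_image_length_pos)
  have "Q * ?s \<le> e * ?S" using e s(1) cut_upper[of p s e] h(2) by linarith
  also have "\<dots> \<le> e * (C ^ 2 * ?s)" by (intro mult_left_mono max_le_min) simp
  finally have "Q * ?s \<le> (e * C ^ 2) * ?s" by (simp add: mult.assoc)
  then have Qe: "Q \<le> e * C ^ 2" using spos by simp
  have QC: "Q = (C ^ 2 * (K + 1) + 2) * C ^ 2 + 1"
    by (simp add: Q_def algebra_simps power4_eq_xxxx power2_eq_square)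
  have lower: "C ^ 2 * (K + 1) + 2 \<le> e"
  proof (rule ccontr)
    assume "\<not> ?thesis"
    then have "e * C ^ 2 \<le> (C ^ 2 * (K + 1) + 2) * C ^ 2" by (intro mult_right_mono) auto
    with Qe QC show False by linarith
  qed
  then have "2 \<le> e" by linarith
  then obtain e' where "e = 2 + e'" using le_Suc_ex by blast
  then have e': "e = Suc (Suc e')" by simp
  have "\<not> a + h \<le> cut p (s + Suc e')"
    by (rule not_less_Least) (use e' in \<open>simp add: e_def\<close>)
  then have "e' * ?s \<le> Q * ?S" using cut_lower[of p "Suc s" e'] s(2) h(1) by simp
  also have "\<dots> \<le> Q * (C ^ 2 * ?s)" by (intro mult_left_mono max_le_min) simp
  finally have "e' * ?s \<le> (C ^ 2 * Q) * ?s" by (simp add: mult_ac)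
  then have upper: "e \<le> C ^ 2 * Q + 2" using spos e' by simp
  have "covering i j p m s e"
    unfolding covering_def h_def[symmetric] using a m s e eq by blast
  with lower upper that show ?thesis by blast
qed

text \<open>The two levels see the same pair of words. The copy found at level \<open>p\<close> is moved into the
  covering word of level \<open>q\<close> (position \<open>b\<close>) and lifted by \<open>q - p\<close> levels. It lands in the same
  block as the copy found at level \<open>q\<close>, so both coincide. Stopping the lift one level before \<open>q\<close>
  gives occurrences of \<open>\<sigma>\<^sup>q\<^sup>-\<^sup>1(v)\<close>, at \<open>x0\<close> and at \<open>y0\<close>, whose images under \<open>\<sigma>\<close> are the
  neighbourhoods of \<open>i\<close> and of \<open>j\<close>.\<close>

lemma coverings_align:
  assumes "p < q"
    and cov_p: "covering i j p m' s' e" and cov_q: "covering i j q m s e"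
    and v: "factor u m' (m' + Q) = factor u m (m + Q)"
    and w: "factor u s' (s' + e) = factor u s (s + e)" and "1 \<le> e"
  obtains x y where "u x = u y" "cut 1 x \<le> i" "i < cut 1 (Suc x)" "cut 1 y \<le> j"
    "i - cut 1 x = j - cut 1 y"
proof -
  define h' where "h' = cut p (m' + Q) - cut p m'"
  define h where "h = cut q (m + Q) - cut q m"
  obtain a' where p: "cut p s' \<le> a'" "a' < cut p (Suc s')" "a' + h' \<le> cut p (s' + e)"
    "factor u a' (a' + h') = factor u (cut p m') (cut p m' + h')"
    using cov_p unfolding covering_def h'_def by blast
  obtain a where q: "a + i = cut q m + j" "cut q m \<le> i" "i < cut q (Suc m)"
    "cut q s \<le> a" "a < cut q (Suc s)"
    "factor u a (a + h) = factor u (cut q m) (cut q m + h)"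
    using cov_q unfolding covering_def h_def by blast
  define r where "r = q - 1 - p"
  have r: "q = 1 + (r + p)" using assms(1) by (simp add: r_def)
  have cutq: "cut q n = cut 1 (cut r (cut p n))" for n
    unfolding r by (simp only: cut_add)
  define b where "b = cut p s + (a' - cut p s')"
  have vlen: "cut p (m' + Q) + cut p m = cut p (m + Q) + cut p m'"
    by (rule transport_cut[OF v order_refl])
  have hm: "cut p (m + Q) = cut p m + h'"
    using vlen cut_mono[of m' "m' + Q" p] unfolding h'_def by linarith
  have hm': "cut p (m' + Q) = cut p m' + h'"
    using cut_mono[of m' "m' + Q" p] unfolding h'_def by linarith
  have slen: "cut p (s' + 1) + cut p s = cut p (s + 1) + cut p s'"
    "cut p (s' + e) + cut p s = cut p (s + e) + cut p s'"
    using transport_cut[OF w \<open>1 \<le> e\<close>, of p] transport_cut[OF w order_refl, of p] by simp_all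
  have bs: "cut p s \<le> b" "b < cut p (Suc s)"
    using p(1,2) slen(1) unfolding b_def by simp_all
  note sm = factor_eqD[OF transport_factor[OF w, of p]]
  have b1: "factor u b (b + h') = factor u a' (a' + h')"
    unfolding factor_eq_iff
  proof (intro allI impI)
    fix t assume "t < h'"
    then show "u (b + t) = u (a' + t)"
      using sm[of "a' - cut p s' + t"] p(1,3) unfolding b_def by (simp add: add.assoc)
  qed
  also have "\<dots> = factor u (cut p m) (cut p m + h')"
    using p(4) transport_factor[OF v, of p] unfolding hm hm' by simp
  finally have b: "factor u b (b + h') = factor u (cut p m) (cut p m + h')" .
  define y0 where "y0 = cut r b"
  define x0 where "x0 = cut (r + p) m"
  define H where "H = cut (r + p) (m + Q) - cut (r + p) m"
  have Hx: "cut r (cut p m + h') = x0 + H"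
    using cut_mono[of m "m + Q" "r + p"] unfolding x0_def H_def by (simp add: cut_add hm)
  have Hy: "cut r (b + h') = y0 + H"
    using transport_cut[OF b order_refl, of r] Hx unfolding y0_def x0_def
    by (simp add: cut_add)
  have xy: "factor u y0 (y0 + H) = factor u x0 (x0 + H)"
    using transport_factor[OF b, of r] unfolding Hx Hy by (simp add: y0_def x0_def cut_add)
  have x0q: "cut 1 x0 = cut q m" "cut 1 (x0 + H) = cut q (m + Q)"
    using cut_mono[of m "m + Q" "r + p"] by (simp_all only: r x0_def H_def cut_add[of 1] le_add_diff_inverse le_add1)
  have y0h: "cut 1 (y0 + H) = cut 1 y0 + h"
    using transport_cut[OF xy order_refl, of 1] cut_mono[of m "m + Q" q]
    unfolding x0q h_def by linarith
  have same: "factor u (cut 1 y0) (cut 1 y0 + h) = factor u (cut q m) (cut q m + h)"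
    using transport_factor[OF xy, of 1] cut_mono[of m "m + Q" q]
    unfolding y0h x0q h_def by simp
  have y0s: "cut q s \<le> cut 1 y0" "cut 1 y0 \<le> cut q (Suc s)"
    unfolding cutq y0_def using bs by (simp_all add: cut_mono)
  have Kd: "K * d \<le> h" if "d \<le> max_image_length \<sigma> q" for d
  proof -
    have "K * d \<le> K * (C ^ 2 * min_image_length \<sigma> q)"
      using that max_le_min[of q] by (intro mult_left_mono) auto
    also have "\<dots> \<le> Q * min_image_length \<sigma> q"
      using KC2_le_Q by (metis mult.assoc mult_le_mono1)
    also have "\<dots> \<le> h" unfolding h_def using cut_lower[of q m Q] by linarith
    finally show ?thesis .
  qed
  have ss: "cut q (Suc s) \<le> cut q s + max_image_length \<sigma> q" using cut_upper[of q s 1] by simp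
  \<comment> \<open>both copies of \<open>\<sigma>\<^sup>q(v)\<close> start within one block, hence at distance at most its length\<close>
  have "a = cut 1 y0"
  proof (cases "a \<le> cut 1 y0")
    case True
    show ?thesis
    proof (rule close_occurrences_coincide[OF _ True])
      show "factor u a (a + h) = factor u (cut 1 y0) (cut 1 y0 + h)" using q(6) same by simp
      show "K * (cut 1 y0 - a) \<le> h" using ss y0s q(4) by (intro Kd) linarith
    qed
  next
    case False
    then have le: "cut 1 y0 \<le> a" by simp
    have "cut 1 y0 = a"
    proof (rule close_occurrences_coincide[OF _ le])
      show "factor u (cut 1 y0) (cut 1 y0 + h) = factor u a (a + h)" using q(6) same by simp
      show "K * (a - cut 1 y0) \<le> h" using ss y0s q(5) by (intro Kd) linarith
    qed
    then show ?thesis by simp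
  qed
  with q(1) have ij: "cut 1 y0 + i = cut 1 x0 + j" unfolding x0q by simp
  obtain x where x: "cut 1 x \<le> i" "i < cut 1 (Suc x)" by (rule cut_locate)
  have "x0 \<le> x"
  proof (rule ccontr)
    assume "\<not> x0 \<le> x"
    then have "cut 1 (Suc x) \<le> cut 1 x0" by (intro cut_mono) simp
    then show False using x q(2) x0q by simp
  qed
  have "x < x0 + H"
  proof (rule ccontr)
    assume "\<not> x < x0 + H"
    then have "cut 1 (x0 + H) \<le> cut 1 x" by (intro cut_mono) simp
    moreover have "cut q (Suc m) \<le> cut q (m + Q)" using Q_pos by (intro cut_mono) simp
    ultimately show False using x q(3) x0q by simp
  qed
  define t where "t = x - x0"
  have t: "x = x0 + t" "t < H" using \<open>x0 \<le> x\<close> \<open>x < x0 + H\<close> by (auto simp: t_def)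
  have len: "cut 1 (y0 + t) + cut 1 x0 = cut 1 x + cut 1 y0"
    using transport_cut[OF xy, of t 1] t by simp
  show ?thesis
  proof (rule that[of x "y0 + t"])
    show "u x = u (y0 + t)" using xy t unfolding factor_eq_iff by simp
    show "cut 1 (y0 + t) \<le> j" "i - cut 1 x = j - cut 1 (y0 + t)"
      using len ij x(1) by linarith+
  qed (use x in auto)
qed

text \<open>The product \<open>(K Q) (\<Sum>n. K n)\<close>, which is \<open>p0 - 1\<close>, bounds the number of pairs consisting of
  the word of length \<open>Q\<close> above \<open>i\<close> and the covering word above \<open>j\<close>; one of the \<open>p0\<close> levels must
  repeat a pair.\<close>

lemma window_determines_block:
  assumes p0: "p0 = K ^ 2 * Q * (\<Sum>n = C ^ 2 * (K + 1) + 2 .. C ^ 2 * Q + 2. n) + 1"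
    and L: "L = Q * max_image_length \<sigma> p0" "L \<le> i" "L \<le> j"
    and window: "factor u (i - L) (i + L) = factor u (j - L) (j + L)"
  obtains x y where "u x = u y" "cut 1 x \<le> i" "i < cut 1 (Suc x)" "cut 1 y \<le> j"
    "i - cut 1 x = j - cut 1 y"
proof -
  define I where "I = {C ^ 2 * (K + 1) + 2 .. C ^ 2 * Q + 2}"
  have "\<forall>p\<in>{1..p0}. \<exists>m s e. covering i j p m s e \<and> e \<in> I"
  proof
    fix p assume "p \<in> {1..p0}"
    then have "Q * max_image_length \<sigma> p \<le> L"
      unfolding L(1) by (intro mult_left_mono max_image_length_mono) auto
    from covering_exists[OF this L(2,3) window]
    show "\<exists>m s e. covering i j p m s e \<and> e \<in> I" unfolding I_def by (metis atLeastAtMost_iff)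
  qed
  then obtain m s e where cov: "\<And>p. p \<in> {1..p0} \<Longrightarrow> covering i j p (m p) (s p) (e p)"
    and e: "\<And>p. p \<in> {1..p0} \<Longrightarrow> e p \<in> I"
    by metis
  define f where "f p = (factor u (m p) (m p + Q), factor u (s p) (s p + e p))" for p
  let ?T = "words Q \<times> (\<Union>n\<in>I. words n)"
  have fin: "finite ?T" using finite_words by (auto simp: I_def)
  have sub: "f ` {1..p0} \<subseteq> ?T"
  proof (rule image_subsetI)
    fix p assume "p \<in> {1..p0}"
    then have "e p \<in> I" by (rule e)
    moreover have "factor u x (x + n) \<in> words n" for x n by (simp add: words_def)
    ultimately show "f p \<in> ?T" unfolding f_def by blast
  qed
  have "card (\<Union>n\<in>I. words n) \<le> (\<Sum>n\<in>I. card (words n))"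
    by (rule card_UN_le) (simp add: I_def)
  also have "\<dots> \<le> (\<Sum>n\<in>I. K * n)" by (intro sum_mono card_words_le) (auto simp: I_def)
  finally have "card ?T \<le> (K * Q) * (\<Sum>n\<in>I. K * n)"
    unfolding card_cartesian_product by (intro mult_mono card_words_le Q_pos) auto
  also have "\<dots> = K ^ 2 * Q * \<Sum>I"
    by (simp add: sum_distrib_left[symmetric] power2_eq_square)
  also have "\<dots> < p0" by (simp add: p0 I_def)
  finally have "card ?T < card {1..p0}" by simp
  moreover have "card (f ` {1..p0}) \<le> card ?T" by (rule card_mono[OF fin sub])
  ultimately have "\<not> inj_on f {1..p0}" by (intro pigeonhole) simp
  then obtain p q where pq: "p \<in> {1..p0}" "q \<in> {1..p0}" "f p = f q" "p < q"
    unfolding inj_on_def by (metis linorder_neqE_nat)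
  have v: "factor u (m p) (m p + Q) = factor u (m q) (m q + Q)"
    and w: "factor u (s p) (s p + e p) = factor u (s q) (s q + e q)"
    using pq(3) by (auto simp: f_def)
  have ee: "e p = e q" using arg_cong[OF w, of length] by simp
  have "1 \<le> e q" using e[OF pq(2)] by (simp add: I_def)
  then show ?thesis
    using coverings_align[OF pq(4) _ cov[OF pq(2)] v] cov[OF pq(1)] w that unfolding ee by metis
qed

lemma cut_1: "cut 1 n = length (subst_word \<sigma> (factor u 0 n))"
  by (simp add: cut_def)

lemma cut_points_eq: "cut_points \<sigma> u = range (cut 1)"
proof (intro equalityI subsetI)
  fix x assume "x \<in> cut_points \<sigma> u"
  then have "x = cut 1 0 \<or> (\<exists>n. x = cut 1 n)"
    unfolding cut_points_def cut_1 by (auto simp: factor_def subst_word_def)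
  then show "x \<in> range (cut 1)" by blast
next
  fix x assume "x \<in> range (cut 1)"
  then obtain n where n: "x = cut 1 n" by blast
  show "x \<in> cut_points \<sigma> u"
  proof (cases "n = 0")
    case False
    then have "1 \<le> n" by simp
    then show ?thesis unfolding cut_points_def n cut_1 by blast
  qed (simp add: n cut_points_def)
qed

lemma cut_block_unique:
  assumes "cut p m \<le> i" "i < cut p (Suc m)" "cut p n \<le> i" "i < cut p (Suc n)"
  shows "m = n"
proof (rule ccontr)
  assume "m \<noteq> n"
  then consider "Suc m \<le> n" | "Suc n \<le> m" by linarith
  then show False using assms cut_mono[of "Suc m" n p] cut_mono[of "Suc n" m p]
    by cases linarith+
qed

lemma local_unique_composition_index:
  assumes p0: "p0 = K ^ 2 * Q * (\<Sum>n = C ^ 2 * (K + 1) + 2 .. C ^ 2 * Q + 2. n) + 1"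
  shows "local_unique_composition \<sigma> u (Q * max_image_length \<sigma> p0)"
proof -
  define L where "L = Q * max_image_length \<sigma> p0"
  have "1 \<le> max_image_length \<sigma> p0"
    using image_length_le_max[of p0 \<sigma> "u 0"] img_letter_pos[of p0 "u 0"] by linarith
  then have L1: "1 \<le> L" using Q_pos by (simp add: L_def)
  note block = window_determines_block[OF p0 L_def]
  have "j \<in> range (cut 1)"
    if ij: "L \<le> i" "L \<le> j" "factor u (i - L) (i + L) = factor u (j - L) (j + L)"
      and i_cut: "i \<in> range (cut 1)" for i j
  proof -
    obtain n where i: "i = cut 1 n" using i_cut by blast
    obtain x y where xy: "cut 1 x \<le> i" "i < cut 1 (Suc x)" "cut 1 y \<le> j"
      "i - cut 1 x = j - cut 1 y"
      using block[OF ij] by blast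
    have "i < cut 1 (Suc n)" unfolding i cut_Suc using img_letter_pos[of 1 "u n"] by linarith
    then have "x = n" using cut_block_unique[OF xy(1,2), of n] i by simp
    then have "j = cut 1 y" using xy i by simp
    then show ?thesis by simp
  qed
  moreover have "u m = u n"
    if ij: "L \<le> i" "L \<le> j" "factor u (i - L) (i + L) = factor u (j - L) (j + L)"
      and m: "cut 1 m \<le> i" "i < cut 1 (Suc m)" and n: "cut 1 n \<le> j" "j < cut 1 (Suc n)"
    for i j m n
  proof -
    obtain x y where xy: "u x = u y" "cut 1 x \<le> i" "i < cut 1 (Suc x)" "cut 1 y \<le> j"
      "i - cut 1 x = j - cut 1 y"
      using block[OF ij] by blast
    have "j < cut 1 (Suc y)"
      using xy unfolding cut_Suc by simp
    then show ?thesis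
      using xy cut_block_unique[OF m xy(2,3)] cut_block_unique[OF n xy(4)] by simp
  qed
  ultimately show ?thesis
    unfolding local_unique_composition_def bilaterally_recognizable_def L_def[symmetric]
      cut_points_eq cut_1[symmetric] Suc_eq_plus1[symmetric]
    using L1 by blast
qed

end

theorem lemma4p2:
  fixes \<sigma> :: "'a::finite \<Rightarrow> 'a list" and u :: "nat \<Rightarrow> 'a"
    and l :: real and \<beta> :: "real ^ 'a"
  assumes "2 \<le> CARD('a)"
    and "substitution \<sigma>"
    and "primitive_subst \<sigma>"
    and "subst_seq \<sigma> u = u"
    and "aperiodic_seq u"
    and "perron_eigenvalue (subst_matrix \<sigma>) l"
    and "positive_right_eigenvector (subst_matrix \<sigma>) l \<beta>"
  shows "let C = const_C \<beta>;
             K = const_K l \<beta> u;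
             p\<^sub>0 = K ^ 2 * (C ^ 4 * (K + 1) + 2 * C ^ 2 + 1) *
                  (\<Sum>n = C ^ 2 * (K + 1) + 2 ..
                       (K + 1) * C ^ 6 + 2 * C ^ 4 + C ^ 2 + 2. n) + 1;
             L\<^sub>0 = (C ^ 4 * (K + 1) + 2 * C ^ 2 + 1) * max_image_length \<sigma> p\<^sub>0
         in local_unique_composition \<sigma> u L\<^sub>0"
proof -
  interpret primitive_aperiodic \<sigma> u l \<beta>
    using assms by unfold_locales
  have range_end: "C ^ 2 * (C ^ 4 * (K + 1) + 2 * C ^ 2 + 1) + 2 =
      (K + 1) * C ^ 6 + 2 * C ^ 4 + C ^ 2 + 2"
    by (simp add: algebra_simps power_add[symmetric])
  show ?thesis
    using local_unique_composition_index[OF refl] unfolding Q_def range_end Let_def .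
qed

end
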